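(* Let $K\subset\mathbb R^n$, $n\geq 3$, be a convex body, let $p\in\mathbb R^n$ be any point, and let $1\leq k<n-1$. Suppose there is an $(n-k)$-dimensional linear subspace $T\subset\mathbb R^n$ such that for every affine hyperplane $H\subset\mathbb R^n$ passing through $p$, the intersection $K\cap H$ is invariant under the orthogonal reflection of $H$ through some $k$-dimensional affine subspace $A_H\subset H$ passing through $p$, whose orthogonal complement $V_H=\vec A_H^{\,\perp}\cap\vec H$ (of dimension $n-1-k$) satisfies $V_H\subset T$. Then $K$ is a body of $k$-revolution, with hyperaxis of $k$-revolution passing through $p$.
   Context: A convex body in $\mathbb R^n$ is a compact convex set with non-empty interior. For an affine subspace $W$, $\vec W$ denotes its associated linear (direction) space. For an affine subspace $A\subset H$, the orthogonal reflection of $H$ through $A$ is the map $a+v\mapsto a-v$ for $a\in A$, $v\in\vec A^{\,\perp}\cap\vec H$. A set $X$ is invariant under a map $g$ if $gX=X$. $K$ is a body of $k$-revolution with hyperaxis the $k$-dimensional affine subspace $A\subset\mathbb R^n$ if $gK=K$ for every Euclidean isometry $g$ of $\mathbb R^n$ fixing every point of $A$ (equivalently, $K$ is invariant under the full orthogonal group $\mathrm O(n-k,\mathbb R)$ acting on the orthogonal complement of $A$). *)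

theory Defs
  imports "HOL-Analysis.Analysis"
begin

definition convex_body :: "'a::euclidean_space set \<Rightarrow> bool" where
  "convex_body K \<longleftrightarrow> compact K \<and> convex K \<and> interior K \<noteq> {}"

(* Intended for nonempty affine W, where it is a linear subspace of dimension aff_dim W. *)
definition direction_space :: "'a::euclidean_space set \<Rightarrow> 'a set" where
  "direction_space W = {x - y | x y. x \<in> W \<and> y \<in> W}"

definition affine_hyperplane :: "'a::euclidean_space set \<Rightarrow> bool" where
  "affine_hyperplane H \<longleftrightarrow> affine H \<and> aff_dim H = int DIM('a) - 1"

definition normal_space_in :: "'a::euclidean_space set \<Rightarrow> 'a set \<Rightarrow> 'a set" where
  "normal_space_in H A = orthogonal_comp (direction_space A) \<inter> direction_space H"

(* Only meaningful for x in H, with A a nonempty affine subspace of the affine subspace H;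
   see orthogonal_reflection_eq and orthogonal_decomposition_in below. *)
definition orthogonal_reflection :: "'a::euclidean_space set \<Rightarrow> 'a set \<Rightarrow> 'a \<Rightarrow> 'a" where
  "orthogonal_reflection H A x =
     (THE y. \<exists>a\<in>A. \<exists>v\<in>normal_space_in H A. x = a + v \<and> y = a - v)"

definition invariant_under :: "('a \<Rightarrow> 'a) \<Rightarrow> 'a set \<Rightarrow> bool" where
  "invariant_under g X \<longleftrightarrow> g ` X = X"

(* Distance-preserving self-maps of a Euclidean space are automatically bijective. *)
definition euclidean_isometry :: "('a::euclidean_space \<Rightarrow> 'a) \<Rightarrow> bool" where
  "euclidean_isometry g \<longleftrightarrow> (\<forall>x y. dist (g x) (g y) = dist x y)"

definition body_of_revolution_with_hyperaxis ::
    "nat \<Rightarrow> 'a::euclidean_space set \<Rightarrow> 'a set \<Rightarrow> bool" where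
  "body_of_revolution_with_hyperaxis k A K \<longleftrightarrow>
     affine A \<and> aff_dim A = int k \<and>
     (\<forall>g. euclidean_isometry g \<and> (\<forall>a\<in>A. g a = a) \<longrightarrow> invariant_under g K)"

lemma orthogonal_decomposition_unique:
  assumes "a \<in> A" "b \<in> A" "v \<in> normal_space_in H A" "w \<in> normal_space_in H A"
    and eq: "a + v = b + w"
  shows "a = b" "v = w"
proof -
  have ab: "a - b \<in> direction_space A"
    using assms unfolding direction_space_def by blast
  have "(a - b) \<bullet> v = 0" "(a - b) \<bullet> w = 0"
    using ab assms(3,4) unfolding normal_space_in_def orthogonal_comp_def orthogonal_def by auto
  moreover have "a - b = w - v"
    using eq by (simp add: algebra_simps)
  ultimately have "(a - b) \<bullet> (a - b) = 0"
    by (metis inner_diff_right diff_self)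
  then show "a = b" by simp
  with eq show "v = w" by simp
qed

lemma orthogonal_reflection_eq:
  assumes "a \<in> A" "v \<in> normal_space_in H A"
  shows "orthogonal_reflection H A (a + v) = a - v"
  unfolding orthogonal_reflection_def
proof (rule the_equality)
  show "\<exists>a'\<in>A. \<exists>v'\<in>normal_space_in H A. a + v = a' + v' \<and> a - v = a' - v'"
    using assms by blast
next
  fix y assume "\<exists>a'\<in>A. \<exists>v'\<in>normal_space_in H A. a + v = a' + v' \<and> y = a' - v'"
  then show "y = a - v"
    using orthogonal_decomposition_unique assms by metis
qed

lemma orthogonal_decomposition_in:
  assumes A: "affine A" "A \<noteq> {}" and H: "affine H" "A \<subseteq> H" and x: "x \<in> H"
  shows "\<exists>a\<in>A. \<exists>v\<in>normal_space_in H A. x = a + v"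
proof -
  obtain c where c: "c \<in> A" using A by blast
  define D where "D = (\<lambda>y. - c + y) ` A"
  have D: "subspace D"
    unfolding D_def using affine_diffs_subspace[OF A(1) c] by simp
  obtain y z where y: "y \<in> D" and z: "\<And>w. w \<in> D \<Longrightarrow> orthogonal z w" and eq: "x - c = y + z"
    using orthogonal_subspace_decomp_exists[of D "x - c"] D by (metis span_eq_iff)
  from y obtain a where a: "a \<in> A" "y = a - c" unfolding D_def by auto
  have xa: "x - a = z" using eq a by (simp add: algebra_simps)
  have "direction_space A \<subseteq> D"
  proof
    fix u assume "u \<in> direction_space A"
    then obtain p q where "p \<in> A" "q \<in> A" "u = p - q" unfolding direction_space_def by blast
    then have "- c + p \<in> D" "- c + q \<in> D" "u = (- c + p) - (- c + q)" unfolding D_def by auto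
    then show "u \<in> D" using subspace_diff[OF D] by blast
  qed
  then have "z \<in> orthogonal_comp (direction_space A)"
    using z unfolding orthogonal_comp_def by (auto simp: orthogonal_commute)
  moreover have "z \<in> direction_space H"
    unfolding direction_space_def using xa x a H by blast
  ultimately have "z \<in> normal_space_in H A" unfolding normal_space_in_def by blast
  moreover have "x = a + z" using xa by (simp add: algebra_simps)
  ultimately show ?thesis using a by blast
qed

end

theory Submission
  imports Defs
begin

text \<open>
  Put the origin at \<open>p\<close> and write a point of the space as \<open>y + z\<close> with \<open>y\<close> in \<open>T\<close> and \<open>z\<close> in
  the orthogonal complement of \<open>T\<close>. That complement has dimension \<open>k\<close>, and it turns out to be the
  direction of the hyperaxis.

  Let \<open>u\<close> be a unit vector of \<open>T\<close>, let \<open>s\<close> be orthogonal to \<open>T\<close>, and let \<open>H\<close> be the hyperplane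
  through the origin normal to \<open>u + s\<close>. The space negated by the reflection of \<open>H\<close> lies in the
  intersection of \<open>T\<close> with the orthogonal complement of \<open>u\<close>, and both have dimension
  \<open>n - k - 1\<close>; so they coincide (\<open>normal_space_eq\<close>). The reflection of \<open>H\<close> is therefore forced: on
  a point \<open>y + z\<close> of \<open>H\<close> it keeps \<open>z\<close> and sends \<open>y\<close> to \<open>2 (y \<bullet> u) u - y\<close>, its image under the
  half-turn of \<open>T\<close> about the line of \<open>u\<close>. When \<open>z \<noteq> 0\<close>, one can choose \<open>s\<close> on the line of \<open>z\<close> so
  that \<open>H\<close> contains \<open>y + z\<close>. Hence every slice of \<open>K\<close> over a nonzero \<open>z\<close> is invariant under every
  half-turn about a line of \<open>T\<close>
  (\<open>half_turn_mem_off_central_slice\<close>).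

  Such hyperplanes through a point \<open>y\<close> of the central slice \<open>z = 0\<close> give only the axes \<open>u\<close>
  orthogonal to \<open>y\<close>, but each of its points is a
  limit, along a segment in \<open>K\<close>, of points of \<open>K\<close> in other slices (\<open>half_turn_mem\<close>).
  As \<open>dim T \<ge> 2\<close>, half-turns about lines act transitively on the spheres of \<open>T\<close>
  (\<open>half_turn_transitive\<close>), so whether \<open>y + z\<close> lies in \<open>K\<close> depends only on \<open>z\<close> and \<open>norm y\<close>. An
  isometry that fixes the hyperaxis pointwise preserves both of these
  (\<open>isometry_fixing_complement\<close>).
\<close>

section \<open>Orthogonal decompositions and half-turns about lines\<close>

lemma subspace_orthogonal_comp_decomp:
  fixes T :: "'a::euclidean_space set"
  assumes "subspace T"
  obtains y z where "y \<in> T" "z \<in> orthogonal_comp T" "x = p + z + y"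
proof -
  obtain y z where y: "y \<in> span T" and z: "\<And>w. w \<in> span T \<Longrightarrow> orthogonal z w" and "x - p = y + z"
    using orthogonal_subspace_decomp_exists[of T "x - p"] by blast
  moreover have "y \<in> T"
    using y assms by (metis span_eq_iff)
  moreover have "z \<in> orthogonal_comp T"
    using z by (auto simp: orthogonal_comp_def orthogonal_commute span_base)
  ultimately show thesis
    by (intro that[of y z]) (simp_all add: algebra_simps)
qed

lemma dim_orthogonal_in_subspace:
  fixes T :: "'a::euclidean_space set"
  assumes "subspace T" "u \<in> T"
  shows "dim {v \<in> T. u \<bullet> v = 0} + dim {u} = dim T"
proof -
  have "{v \<in> T. u \<bullet> v = 0} = {v \<in> T. \<forall>x \<in> span {u}. orthogonal x v}"
    by (auto simp: span_singleton orthogonal_def)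
  moreover have "span {u} \<subseteq> T"
    using assms by (simp add: span_minimal)
  ultimately show ?thesis
    using dim_subspace_orthogonal_to_vectors[of "span {u}" T] assms by simp
qed

text \<open>
  The axis is the bisector of \<open>y\<close> and \<open>y'\<close>. The bisector degenerates when \<open>y' = - y\<close>; then
  any axis orthogonal to \<open>y\<close> will do, and \<open>dim T \<ge> 2\<close> provides one.
\<close>
lemma half_turn_transitive:
  fixes T :: "'a::euclidean_space set"
  assumes T: "subspace T" "2 \<le> dim T" and y: "y \<in> T" "y' \<in> T" and eq: "norm y = norm y'"
  obtains u where "u \<in> T" "norm u = 1" "y' = (2 * (y \<bullet> u)) *\<^sub>R u - y"
proof (cases "y + y' = 0")
  case True
  have "dim {y} \<le> 1"
    by simp
  then have "dim {v \<in> T. y \<bullet> v = 0} \<noteq> 0"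
    using dim_orthogonal_in_subspace[OF T(1) y(1)] T(2) by linarith
  then obtain v where v: "v \<in> T" "y \<bullet> v = 0" "v \<noteq> 0"
    by (auto simp: dim_eq_0)
  show ?thesis
  proof (rule that[of "v /\<^sub>R norm v"])
    show "v /\<^sub>R norm v \<in> T"
      using v T by (simp add: subspace_scale)
    show "y' = (2 * (y \<bullet> (v /\<^sub>R norm v))) *\<^sub>R (v /\<^sub>R norm v) - y"
      using v True by (simp add: eq_neg_iff_add_eq_0 add.commute)
  qed (use v in simp)
next
  case False
  define b where "b = y + y'"
  have "y \<bullet> y = y' \<bullet> y'"
    using eq by (simp add: norm_eq)
  then have "2 * (y \<bullet> b) = b \<bullet> b"
    unfolding b_def by (simp add: inner_add_left inner_add_right inner_commute)
  then have bis: "2 * (y \<bullet> b) = norm b * norm b"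
    by (simp add: power2_norm_eq_inner flip: power2_eq_square)
  have b: "b \<noteq> 0"
    using False by (simp add: b_def)
  show ?thesis
  proof (rule that[of "b /\<^sub>R norm b"])
    show "b /\<^sub>R norm b \<in> T"
      using y T by (simp add: b_def subspace_scale subspace_add)
    have "(2 * (y \<bullet> (b /\<^sub>R norm b))) *\<^sub>R (b /\<^sub>R norm b) = (2 * (y \<bullet> b) / (norm b * norm b)) *\<^sub>R b"
      by (simp add: divide_simps)
    also have "\<dots> = b"
      using bis b by simp
    finally show "y' = (2 * (y \<bullet> (b /\<^sub>R norm b))) *\<^sub>R (b /\<^sub>R norm b) - y"
      by (simp add: b_def)
  qed (use b in simp)
qed

section \<open>Reflections of hyperplane sections\<close>

lemma direction_space_affine:
  assumes "affine A" "p \<in> A"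
  shows "direction_space A = (+) (- p) ` A"
proof
  show "(+) (- p) ` A \<subseteq> direction_space A"
    using assms by (auto simp: direction_space_def)
  show "direction_space A \<subseteq> (+) (- p) ` A"
  proof
    fix v assume "v \<in> direction_space A"
    then obtain x y where xy: "x \<in> A" "y \<in> A" "v = x - y"
      unfolding direction_space_def by blast
    have "subspace ((+) (- p) ` A)"
      using affine_diffs_subspace[OF assms] .
    then have "(- p + x) - (- p + y) \<in> (+) (- p) ` A"
      using xy by (intro subspace_diff) auto
    then show "v \<in> (+) (- p) ` A"
      using xy by simp
  qed
qed

lemma direction_space_affine_dim:
  fixes A :: "'a::euclidean_space set"
  assumes "affine A" "p \<in> A"
  shows "subspace (direction_space A)" "int (dim (direction_space A)) = aff_dim A"
  using affine_diffs_subspace[OF assms] aff_dim_eq_dim[of p A] assms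
  by (simp_all add: direction_space_affine[OF assms] hull_inc)

lemma dim_normal_space_in:
  fixes A H :: "'a::euclidean_space set"
  assumes A: "affine A" "p \<in> A" and H: "affine H" and sub: "A \<subseteq> H"
  shows "subspace (normal_space_in H A)"
    and "int (dim (normal_space_in H A)) + aff_dim A = aff_dim H"
proof -
  have pH: "p \<in> H"
    using A sub by blast
  show "subspace (normal_space_in H A)"
    unfolding normal_space_in_def
    by (intro subspace_inter subspace_orthogonal_comp direction_space_affine_dim(1)[OF H pH])
  have "normal_space_in H A
      = {y \<in> direction_space H. \<forall>x \<in> direction_space A. orthogonal x y}"
    unfolding normal_space_in_def orthogonal_comp_def by auto
  moreover have "direction_space A \<subseteq> direction_space H"
    unfolding direction_space_def using sub by blast
  ultimately have "dim (normal_space_in H A) + dim (direction_space A) = dim (direction_space H)"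
    using dim_subspace_orthogonal_to_vectors direction_space_affine_dim(1) A H pH by metis
  then show "int (dim (normal_space_in H A)) + aff_dim A = aff_dim H"
    using direction_space_affine_dim(2)[OF A] direction_space_affine_dim(2)[OF H pH] by linarith
qed

text \<open>
  If the normal vector \<open>u + s\<close> of \<open>H\<close> has a nonzero component \<open>u\<close> in \<open>T\<close>, then \<open>T\<close> cuts the direction
  of \<open>H\<close> in a space of dimension \<open>dim T - 1\<close>. A normal space of that dimension inside \<open>T\<close>
  fills it, which leaves no freedom for the reflection.
\<close>
lemma normal_space_eq:
  fixes T :: "'a::euclidean_space set"
  assumes T: "subspace T" "dim T + k = DIM('a)"
    and u: "u \<in> T" "u \<noteq> 0" and s: "s \<in> orthogonal_comp T"
    and H: "H = {x. (u + s) \<bullet> x = (u + s) \<bullet> p}"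
    and A: "affine A" "aff_dim A = int k" "A \<subseteq> H" "p \<in> A" and VT: "normal_space_in H A \<subseteq> T"
  shows "normal_space_in H A = {v \<in> T. u \<bullet> v = 0}"
proof (rule subspace_dim_equal)
  have sT: "s \<bullet> v = 0" if "v \<in> T" for v
    using s that by (auto simp: orthogonal_comp_def orthogonal_def inner_commute)
  have "u + s \<noteq> 0"
    using sT[OF u(1)] u(2) by (metis add.right_neutral inner_add_left inner_eq_zero_iff inner_zero_left)
  then have "aff_dim H = int DIM('a) - 1"
    unfolding H by simp
  moreover have aff: "affine H"
    unfolding H by (rule affine_hyperplane)
  moreover have "dim {u} = 1"
    using u by simp
  ultimately show "dim {v \<in> T. u \<bullet> v = 0} \<le> dim (normal_space_in H A)"
    using dim_normal_space_in(2)[OF A(1,4) aff A(3)] dim_orthogonal_in_subspace[OF T(1) u(1)]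
      T(2) A(2) by linarith
  show "subspace (normal_space_in H A)"
    by (rule dim_normal_space_in(1)[OF A(1,4) aff A(3)])
  have "{v \<in> T. u \<bullet> v = 0} = T \<inter> {v. u \<bullet> v = 0}"
    by auto
  then show "subspace {v \<in> T. u \<bullet> v = 0}"
    using T(1) by (simp add: subspace_inter subspace_hyperplane)
  show "normal_space_in H A \<subseteq> {v \<in> T. u \<bullet> v = 0}"
  proof
    fix v assume v: "v \<in> normal_space_in H A"
    then obtain x y where "x \<in> H" "y \<in> H" "v = x - y"
      unfolding normal_space_in_def direction_space_def by blast
    then have "(u + s) \<bullet> v = 0"
      unfolding H by (simp add: inner_diff_right)
    then show "v \<in> {v \<in> T. u \<bullet> v = 0}"
      using v VT sT by (auto simp: inner_add_left)
  qed
qed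

text \<open>
  A hyperplane normal to a vector \<open>u + s\<close>, with \<open>s\<close> orthogonal to \<open>T\<close>, induces the half-turn about
  \<open>u\<close> on its own points. As \<open>z \<noteq> 0\<close>, a multiple \<open>s\<close> of \<open>z\<close> can be chosen so that the hyperplane
  passes through the given point \<open>p + z + y\<close>.
\<close>
lemma half_turn_mem_off_central_slice:
  fixes K T :: "'a::euclidean_space set"
  assumes T: "subspace T" "dim T + k = DIM('a)"
    and refl: "\<And>H. affine_hyperplane H \<Longrightarrow> p \<in> H \<Longrightarrow>
           \<exists>A. affine A \<and> aff_dim A = int k \<and> A \<subseteq> H \<and> p \<in> A \<and>
               normal_space_in H A \<subseteq> T \<and>
               invariant_under (orthogonal_reflection H A) (K \<inter> H)"
    and u: "u \<in> T" "norm u = 1" and y: "y \<in> T" and z: "z \<in> orthogonal_comp T" "z \<noteq> 0"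
    and mem: "p + z + y \<in> K"
  shows "p + z + ((2 * (y \<bullet> u)) *\<^sub>R u - y) \<in> K"
proof -
  have zT: "z \<bullet> v = 0" "v \<bullet> z = 0" if "v \<in> T" for v
    using z that by (auto simp: orthogonal_comp_def orthogonal_def inner_commute)
  \<comment> \<open>The coefficient solves \<open>(u + s) \<bullet> (z + y) = 0\<close>.\<close>
  define s where "s = (- (y \<bullet> u) / (z \<bullet> z)) *\<^sub>R z"
  have s: "s \<in> orthogonal_comp T"
    unfolding s_def using z(1) by (intro subspace_scale subspace_orthogonal_comp)
  have sy: "s \<bullet> y = 0" and sz: "s \<bullet> z = - (y \<bullet> u)" and su: "s \<bullet> u = 0"
    using z(2) zT y u by (simp_all add: s_def)
  have u0: "u \<noteq> 0"
    using u by auto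
  define H where "H = {x. (u + s) \<bullet> x = (u + s) \<bullet> p}"
  have "(u + s) \<bullet> u \<noteq> 0"
    using u0 su by (simp add: inner_add_left)
  then have "u + s \<noteq> 0"
    by auto
  then have hyp: "affine_hyperplane H"
    unfolding affine_hyperplane_def H_def by (simp add: affine_hyperplane aff_dim_hyperplane)
  have "p \<in> H"
    by (simp add: H_def)
  then obtain A where A: "affine A" "aff_dim A = int k" "A \<subseteq> H" "p \<in> A"
    and VT: "normal_space_in H A \<subseteq> T"
    and inv: "invariant_under (orthogonal_reflection H A) (K \<inter> H)"
    by (elim refl[OF hyp, THEN exE] conjE)
  have V: "normal_space_in H A = {v \<in> T. u \<bullet> v = 0}"
    by (rule normal_space_eq[OF T u(1) u0 s H_def A VT])
  define v where "v = y - (y \<bullet> u) *\<^sub>R u"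
  define a where "a = p + z + (y \<bullet> u) *\<^sub>R u"
  have uu: "u \<bullet> u = 1"
    using u(2) by (simp add: norm_eq_1)
  have v: "v \<in> normal_space_in H A"
    unfolding V using y u T uu
    by (auto simp: v_def subspace_diff subspace_scale inner_diff_right inner_commute)
  have xH: "a + v \<in> H"
    using zT[OF u(1)] sy sz
    by (simp add: H_def a_def v_def inner_add_left inner_add_right inner_commute)
  \<comment> \<open>The point \<open>a\<close> lies on the mirror because \<open>a - p\<close> is orthogonal to the normal space:
    the decomposition \<open>a' + v'\<close> of \<open>a + v\<close> along the mirror must be this one.\<close>
  have "affine H"
    unfolding H_def by (rule affine_hyperplane)
  then obtain a' v' where a': "a' \<in> A" and v': "v' \<in> normal_space_in H A" and eq: "a + v = a' + v'"
    using orthogonal_decomposition_in[OF A(1) _ _ A(3) xH] A(4) by blast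
  have d: "v - v' \<in> normal_space_in H A"
    using v v' dim_normal_space_in(1)[OF A(1,4) \<open>affine H\<close> A(3)] by (simp add: subspace_diff)
  have "a' - p \<in> direction_space A"
    using a' A(4) by (auto simp: direction_space_def)
  then have "(a' - p) \<bullet> (v - v') = 0"
    using d by (auto simp: normal_space_in_def orthogonal_comp_def orthogonal_def)
  moreover have "(a - p) \<bullet> (v - v') = 0"
    using d zT unfolding V by (auto simp: a_def inner_add_left)
  moreover have "v - v' = (a' - p) - (a - p)"
    using eq by (simp add: algebra_simps)
  ultimately have "(v - v') \<bullet> (v - v') = 0"
    by (metis inner_diff_left diff_self)
  then have "a \<in> A"
    using eq a' by simp
  then have "orthogonal_reflection H A (a + v) = a - v"
    using v by (rule orthogonal_reflection_eq)
  moreover have "a + v = p + z + y"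
    by (simp add: a_def v_def)
  ultimately have "a - v \<in> K"
    using inv mem xH unfolding invariant_under_def by (metis IntD1 IntI imageI)
  moreover have "a - v = p + z + ((2 * (y \<bullet> u)) *\<^sub>R u - y)"
    by (simp add: a_def v_def scaleR_2 algebra_simps flip: scaleR_scaleR)
  ultimately show ?thesis
    by simp
qed

section \<open>The central slice\<close>

text \<open>
  Moving from a point of the central slice towards a point \<open>q\<close> of \<open>K\<close> outside \<open>p + T\<close> leaves that
  slice at once and stays in \<open>K\<close> by convexity. Half-turns are affine, so the images of these
  points run along a segment, and closedness of \<open>K\<close> catches its endpoint.
\<close>
lemma half_turn_mem:
  fixes K T :: "'a::euclidean_space set"
  assumes T: "subspace T" "dim T + k = DIM('a)"
    and refl: "\<And>H. affine_hyperplane H \<Longrightarrow> p \<in> H \<Longrightarrow>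
           \<exists>A. affine A \<and> aff_dim A = int k \<and> A \<subseteq> H \<and> p \<in> A \<and>
               normal_space_in H A \<subseteq> T \<and>
               invariant_under (orthogonal_reflection H A) (K \<inter> H)"
    and K: "convex_body K" and k: "1 \<le> k"
    and u: "u \<in> T" "norm u = 1" and y: "y \<in> T" and z: "z \<in> orthogonal_comp T"
    and mem: "p + z + y \<in> K"
  shows "p + z + ((2 * (y \<bullet> u)) *\<^sub>R u - y) \<in> K"
proof (cases "z = 0")
  case False
  then show ?thesis
    using half_turn_mem_off_central_slice[OF T refl u y z] mem by blast
next
  case True
  have "aff_dim ((+) p ` T) < int DIM('a)"
    using T k by (simp add: aff_dim_translation_eq aff_dim_subspace)
  then have "interior ((+) p ` T) = {}"
    by (intro low_dim_interior) simp
  moreover have "interior K \<noteq> {}"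
    using K by (simp add: convex_body_def)
  ultimately have "\<not> K \<subseteq> (+) p ` T"
    using interior_mono by blast
  then obtain q where q: "q \<in> K" "q \<notin> (+) p ` T"
    by blast
  obtain y1 z1 where y1T: "y1 \<in> T" and z1T: "z1 \<in> orthogonal_comp T" and q_eq: "q = p + z1 + y1"
    by (rule subspace_orthogonal_comp_decomp[OF T(1)])
  have z10: "z1 \<noteq> 0"
  proof
    assume "z1 = 0"
    then show False
      using q(2) y1T q_eq by simp
  qed
  define R where "R v = (2 * (v \<bullet> u)) *\<^sub>R u - v" for v
  define f where "f t = p + t *\<^sub>R z1 + R ((1 - t) *\<^sub>R y + t *\<^sub>R y1)" for t :: real
  have mem': "f t \<in> K" if t: "0 < t" "t \<le> 1" for t
  proof -
    have "(1 - t) *\<^sub>R (p + z + y) + t *\<^sub>R q \<in> K"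
      using K mem q(1) t by (auto simp: convex_body_def convex_def)
    moreover have "(1 - t) *\<^sub>R (p + z + y) + t *\<^sub>R q
        = p + t *\<^sub>R z1 + ((1 - t) *\<^sub>R y + t *\<^sub>R y1)"
      using True q_eq by (simp add: algebra_simps)
    ultimately have "p + t *\<^sub>R z1 + ((1 - t) *\<^sub>R y + t *\<^sub>R y1) \<in> K"
      by simp
    moreover have "(1 - t) *\<^sub>R y + t *\<^sub>R y1 \<in> T"
      using y y1T T(1) by (simp add: subspace_add subspace_scale)
    moreover have "t *\<^sub>R z1 \<in> orthogonal_comp T" "t *\<^sub>R z1 \<noteq> 0"
      using z1T z10 t by (simp_all add: subspace_orthogonal_comp subspace_scale)
    ultimately show ?thesis
      unfolding f_def R_def using half_turn_mem_off_central_slice[OF T refl u] by blast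
  qed
  have lim: "(\<lambda>n. f (inverse (real (Suc n)))) \<longlonglongrightarrow> f 0"
  proof (rule isCont_tendsto_compose[OF _ LIMSEQ_inverse_real_of_nat])
    show "isCont f 0"
      unfolding f_def R_def by (intro continuous_intros)
  qed
  have in_K: "f (inverse (real (Suc n))) \<in> K" for n
    by (rule mem') (simp_all add: field_simps)
  have "closed K"
    using K by (simp add: convex_body_def compact_imp_closed)
  then have "f 0 \<in> K"
    by (rule closed_sequentially[OF _ in_K lim])
  then show ?thesis
    using True by (simp add: f_def R_def)
qed

section \<open>Isometries fixing the hyperaxis\<close>

text \<open>
  Write \<open>C\<close> for the orthogonal complement of \<open>T\<close>. The distances from a point to all points of
  \<open>p + C\<close> determine its orthogonal projection on \<open>p + C\<close> (the nearest point) and its distance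
  from that projection.
\<close>
lemma isometry_fixing_complement:
  fixes g :: "'a::euclidean_space \<Rightarrow> 'a"
  assumes g: "euclidean_isometry g" "\<And>c. c \<in> orthogonal_comp T \<Longrightarrow> g (p + c) = p + c"
    and y: "y \<in> T" "y' \<in> T" and z: "z \<in> orthogonal_comp T" "z' \<in> orthogonal_comp T"
    and eq: "g (p + z + y) = p + z' + y'"
  shows "z' = z" "norm y' = norm y"
proof -
  have sq: "(dist (p + w + v) (p + c))\<^sup>2 = (norm (w - c))\<^sup>2 + (norm v)\<^sup>2"
    if "v \<in> T" "w \<in> orthogonal_comp T" "c \<in> orthogonal_comp T" for v w c
  proof -
    have "w - c \<in> orthogonal_comp T"
      using that by (simp add: subspace_orthogonal_comp subspace_diff)
    then have "orthogonal (w - c) v"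
      using that(1) by (auto simp: orthogonal_comp_def orthogonal_commute)
    then have "(norm ((w - c) + v))\<^sup>2 = (norm (w - c))\<^sup>2 + (norm v)\<^sup>2"
      by (rule norm_add_Pythagorean)
    then show ?thesis
      by (simp add: dist_norm algebra_simps)
  qed
  have "dist (p + z' + y') (p + c) = dist (p + z + y) (p + c)" if "c \<in> orthogonal_comp T" for c
    using g that eq unfolding euclidean_isometry_def by metis
  then have d: "(norm (z' - c))\<^sup>2 + (norm y')\<^sup>2 = (norm (z - c))\<^sup>2 + (norm y)\<^sup>2"
    if "c \<in> orthogonal_comp T" for c
    using sq[OF y(1) z(1) that] sq[OF y(2) z(2) that] that by simp
  have "(norm (z' - z))\<^sup>2 = 0"
    using d[OF z(1)] d[OF z(2)] by (simp add: norm_minus_commute)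
  then show "z' = z"
    by simp
  then show "norm y' = norm y"
    using d[OF z(1)] by simp
qed

lemma euclidean_isometry_surj:
  fixes g :: "'a::euclidean_space \<Rightarrow> 'a"
  assumes "euclidean_isometry g"
  shows "surj g"
proof -
  have "orthogonal_transformation (\<lambda>x. g x - g 0)"
    using assms by (simp add: orthogonal_transformation_isometry euclidean_isometry_def dist_norm)
  then have "surj (\<lambda>x. g x - g 0)"
    by (rule orthogonal_transformation_surj)
  then have "\<exists>x. y - g 0 = g x - g 0" for y
    by (rule surjD)
  then show ?thesis
    by (auto simp: surj_def)
qed

theorem theorem5:
  fixes K T :: "(real ^ 'n) set" and p :: "real ^ 'n" and k :: nat
  assumes "CARD('n) \<ge> 3"
    and "convex_body K"
    and "1 \<le> k" and "k < CARD('n) - 1"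
    and "subspace T" and "dim T = CARD('n) - k"
    and "\<And>H. affine_hyperplane H \<Longrightarrow> p \<in> H \<Longrightarrow>
           \<exists>A. affine A \<and> aff_dim A = int k \<and> A \<subseteq> H \<and> p \<in> A \<and>
               normal_space_in H A \<subseteq> T \<and>
               invariant_under (orthogonal_reflection H A) (K \<inter> H)"
  shows "\<exists>A. body_of_revolution_with_hyperaxis k A K \<and> p \<in> A"
proof -
  have T: "subspace T" "dim T + k = DIM(real ^ 'n)" and T2: "2 \<le> dim T"
    using assms(4-6) by simp_all
  have slice: "p + z + y' \<in> K"
    if yz: "y \<in> T" "y' \<in> T" "z \<in> orthogonal_comp T" "norm y = norm y'" and mem: "p + z + y \<in> K"
    for y y' z
  proof -
    obtain u where u: "u \<in> T" "norm u = 1" and y': "y' = (2 * (y \<bullet> u)) *\<^sub>R u - y"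
      by (rule half_turn_transitive[OF T(1) T2 yz(1,2,4)])
    show ?thesis
      unfolding y' by (rule half_turn_mem[OF T assms(7) assms(2,3) u yz(1,3) mem])
  qed
  define A where "A = (+) p ` orthogonal_comp T"
  have "invariant_under g K" if g: "euclidean_isometry g" "\<forall>a\<in>A. g a = a" for g
  proof -
    have "g x \<in> K \<longleftrightarrow> x \<in> K" for x
    proof -
      obtain y z where yz: "y \<in> T" "z \<in> orthogonal_comp T" "x = p + z + y"
        by (rule subspace_orthogonal_comp_decomp[OF T(1)])
      obtain y' z' where yz': "y' \<in> T" "z' \<in> orthogonal_comp T" "g x = p + z' + y'"
        by (rule subspace_orthogonal_comp_decomp[OF T(1)])
      have "z' = z" "norm y' = norm y"
        using isometry_fixing_complement[OF g(1) _ yz(1) yz'(1) yz(2) yz'(2)] g(2) yz(3) yz'(3)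
        by (auto simp: A_def)
      then show ?thesis
        using slice[OF yz(1) yz'(1) yz(2)] slice[OF yz'(1) yz(1) yz(2)] yz(3) yz'(3) by auto
    qed
    then have "g -` K = K"
      by blast
    then show ?thesis
      unfolding invariant_under_def using surj_image_vimage_eq[OF euclidean_isometry_surj[OF g(1)], of K]
      by simp
  qed
  moreover have "affine A"
    unfolding A_def using subspace_imp_affine[OF subspace_orthogonal_comp]
    by (simp flip: affine_translation)
  moreover have "aff_dim A = int k"
  proof -
    have "orthogonal_comp T = {y \<in> UNIV. \<forall>x\<in>T. orthogonal x y}"
      by (auto simp: orthogonal_comp_def)
    then have "dim (orthogonal_comp T) + dim T = DIM(real ^ 'n)"
      using dim_subspace_orthogonal_to_vectors[OF T(1) subspace_UNIV] by simp
    then show ?thesis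
      using T(2)
      by (simp add: A_def aff_dim_translation_eq aff_dim_subspace subspace_orthogonal_comp)
  qed
  moreover have "p \<in> A"
    unfolding A_def using subspace_0[OF subspace_orthogonal_comp, of T] by force
  ultimately show ?thesis
    unfolding body_of_revolution_with_hyperaxis_def by blast
qed

end
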